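(* Let $X$ be a topological space and let $A\neq\emptyset$ be a nowhere dense and perfect subset of $X$ which is locally compact. Then $T'(X)$ is not a subring of $B_1(X)$.
   Context: All topological spaces are nonempty and $T_1$. $F(X)$ is the ring of all functions $X\to\mathbb{R}$ with pointwise operations. $T'(X)$ is the ring of all $f\in F(X)$ for which there is an open dense subset $D$ of $X$ such that the restriction $f|_D$ is continuous on $D$. $B_1(X)$ is the subring of $F(X)$ of all pointwise limits of sequences of continuous real-valued functions on $X$. A perfect subset of $X$ is a closed subset which has no isolated points in its relative topology. Local compactness of $A$ refers to its relative topology. *)

theory Defs
  imports "HOL-Analysis.Analysis" "HOL-Algebra.Subrings"
begin

text \<open>
  The space is an abstract topology with carrier \<^term>\<open>topspace X\<close>, and a function on it is
  represented by its extensional representative (\<^term>\<open>undefined\<close> off \<^term>\<open>topspace X\<close>),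
  so that equality of representatives is equality of functions on the space.
\<close>

definition function_ring :: "'a topology \<Rightarrow> ('a \<Rightarrow> real) ring" where
  "function_ring X =
    \<lparr> carrier = topspace X \<rightarrow>\<^sub>E UNIV,
      mult = (\<lambda>f g. \<lambda>x\<in>topspace X. f x * g x),
      one = (\<lambda>x\<in>topspace X. 1),
      zero = (\<lambda>x\<in>topspace X. 0),
      add = (\<lambda>f g. \<lambda>x\<in>topspace X. f x + g x) \<rparr>"

definition T_prime :: "'a topology \<Rightarrow> ('a \<Rightarrow> real) set" where
  "T_prime X = {f \<in> carrier (function_ring X).
    \<exists>D. openin X D \<and> X closure_of D = topspace X \<and>
        continuous_map (subtopology X D) euclideanreal f}"

definition baire_one :: "'a topology \<Rightarrow> ('a \<Rightarrow> real) set" where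
  "baire_one X = {f \<in> carrier (function_ring X).
    \<exists>s :: nat \<Rightarrow> 'a \<Rightarrow> real. (\<forall>n. continuous_map X euclideanreal (s n)) \<and>
        (\<forall>x\<in>topspace X. (\<lambda>n. s n x) \<longlonglongrightarrow> f x)}"

definition baire_one_ring :: "'a topology \<Rightarrow> ('a \<Rightarrow> real) ring" where
  "baire_one_ring X = (function_ring X)\<lparr>carrier := baire_one X\<rparr>"

definition nowhere_dense_in :: "'a topology \<Rightarrow> 'a set \<Rightarrow> bool" where
  "nowhere_dense_in X A \<longleftrightarrow> A \<subseteq> topspace X \<and> X interior_of (X closure_of A) = {}"

text \<open>A point is isolated in the relative topology iff its singleton is relatively open.\<close>

definition perfect_in :: "'a topology \<Rightarrow> 'a set \<Rightarrow> bool" where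
  "perfect_in X A \<longleftrightarrow> closedin X A \<and> (\<forall>x\<in>A. \<not> openin (subtopology X A) {x})"

text \<open>
  The sets above are subrings of the ring of all functions. Hence \<^const>\<open>T_prime\<close> fails to be a
  subring of \<^const>\<open>baire_one_ring\<close> exactly when it is not contained in \<^const>\<open>baire_one\<close>.
\<close>

lemma ring_function_ring: "ring (function_ring X)"
proof (rule ringI)
  show "abelian_group (function_ring X)"
  proof (rule abelian_groupI)
    fix f assume "f \<in> carrier (function_ring X)"
    then show "\<exists>g\<in>carrier (function_ring X). g \<oplus>\<^bsub>function_ring X\<^esub> f = \<zero>\<^bsub>function_ring X\<^esub>"
      by (intro bexI[of _ "\<lambda>x\<in>topspace X. - f x"]) (auto simp: function_ring_def)
  qed (auto simp: function_ring_def fun_eq_iff PiE_def extensional_def)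
  show "Group.monoid (function_ring X)"
    by (rule monoidI) (auto simp: function_ring_def fun_eq_iff PiE_def extensional_def)
qed (auto simp: function_ring_def fun_eq_iff distrib_left distrib_right)

lemma a_inv_function_ring:
  assumes "f \<in> carrier (function_ring X)"
  shows "\<ominus>\<^bsub>function_ring X\<^esub> f = (\<lambda>x\<in>topspace X. - f x)"
proof -
  interpret ring "function_ring X" by (rule ring_function_ring)
  show ?thesis
    by (rule minus_equality) (use assms in \<open>auto simp: function_ring_def\<close>)
qed

lemma subring_T_prime: "subring (T_prime X) (function_ring X)"
proof (rule ring.subringI[OF ring_function_ring])
  show "T_prime X \<subseteq> carrier (function_ring X)"
    by (auto simp: T_prime_def)
  have cong: "continuous_map (subtopology X D) euclideanreal (restrict g (topspace X))
      \<longleftrightarrow> continuous_map (subtopology X D) euclideanreal g" for D g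
    by (auto elim: continuous_map_eq)
  show "\<one>\<^bsub>function_ring X\<^esub> \<in> T_prime X"
    unfolding T_prime_def
    by (auto simp: function_ring_def cong intro!: exI[of _ "topspace X"])
  show "\<ominus>\<^bsub>function_ring X\<^esub> f \<in> T_prime X" if "f \<in> T_prime X" for f
  proof -
    have "f \<in> carrier (function_ring X)"
      using that by (simp add: T_prime_def)
    moreover have "(\<lambda>x\<in>topspace X. - f x) \<in> T_prime X"
      using that by (auto simp: T_prime_def function_ring_def cong intro: continuous_map_minus)
    ultimately show ?thesis
      by (simp add: a_inv_function_ring)
  qed
  fix f g assume f: "f \<in> T_prime X" and g: "g \<in> T_prime X"
  from f obtain D where D: "openin X D" "X closure_of D = topspace X"
      "continuous_map (subtopology X D) euclideanreal f"
    by (auto simp: T_prime_def)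
  from g obtain E where E: "openin X E" "X closure_of E = topspace X"
      "continuous_map (subtopology X E) euclideanreal g"
    by (auto simp: T_prime_def)
  have "openin X (D \<inter> E)"
    using D E by blast
  moreover have "X closure_of (D \<inter> E) = topspace X"
    using D E by (metis closure_of_openin_Int_superset inf.absorb_iff1 openin_subset)
  moreover have "continuous_map (subtopology X (D \<inter> E)) euclideanreal f"
    using D(3) continuous_map_from_subtopology_mono by blast
  moreover have "continuous_map (subtopology X (D \<inter> E)) euclideanreal g"
    using E(3) continuous_map_from_subtopology_mono by blast
  ultimately show "f \<otimes>\<^bsub>function_ring X\<^esub> g \<in> T_prime X" "f \<oplus>\<^bsub>function_ring X\<^esub> g \<in> T_prime X"
    by (auto simp: T_prime_def function_ring_def cong
        intro!: exI[of _ "D \<inter> E"] continuous_map_real_mult continuous_map_add)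
qed

lemma subring_baire_one: "subring (baire_one X) (function_ring X)"
proof (rule ring.subringI[OF ring_function_ring])
  show "baire_one X \<subseteq> carrier (function_ring X)"
    by (auto simp: baire_one_def)
  show "\<one>\<^bsub>function_ring X\<^esub> \<in> baire_one X"
    unfolding baire_one_def
    by (auto simp: function_ring_def intro!: exI[of _ "\<lambda>_ _. 1"])
  show "\<ominus>\<^bsub>function_ring X\<^esub> f \<in> baire_one X" if f: "f \<in> baire_one X" for f
  proof -
    from f obtain s :: "nat \<Rightarrow> 'a \<Rightarrow> real"
      where "\<And>n. continuous_map X euclideanreal (s n)"
        "\<And>x. x \<in> topspace X \<Longrightarrow> (\<lambda>n. s n x) \<longlonglongrightarrow> f x"
      by (auto simp: baire_one_def)
    then have "(\<lambda>x\<in>topspace X. - f x) \<in> baire_one X"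
      by (auto simp: baire_one_def function_ring_def
          intro!: exI[of _ "\<lambda>n x. - s n x"] continuous_map_minus tendsto_minus)
    then show ?thesis
      using f by (simp add: a_inv_function_ring baire_one_def)
  qed
  fix f g assume f: "f \<in> baire_one X" and g: "g \<in> baire_one X"
  from f obtain s :: "nat \<Rightarrow> 'a \<Rightarrow> real"
    where s: "\<And>n. continuous_map X euclideanreal (s n)"
      "\<And>x. x \<in> topspace X \<Longrightarrow> (\<lambda>n. s n x) \<longlonglongrightarrow> f x"
    by (auto simp: baire_one_def)
  from g obtain t :: "nat \<Rightarrow> 'a \<Rightarrow> real"
    where t: "\<And>n. continuous_map X euclideanreal (t n)"
      "\<And>x. x \<in> topspace X \<Longrightarrow> (\<lambda>n. t n x) \<longlonglongrightarrow> g x"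
    by (auto simp: baire_one_def)
  from s t show "f \<otimes>\<^bsub>function_ring X\<^esub> g \<in> baire_one X"
    by (auto simp: baire_one_def function_ring_def
        intro!: exI[of _ "\<lambda>n x. s n x * t n x"] continuous_map_real_mult tendsto_mult)
  from s t show "f \<oplus>\<^bsub>function_ring X\<^esub> g \<in> baire_one X"
    by (auto simp: baire_one_def function_ring_def
        intro!: exI[of _ "\<lambda>n x. s n x + t n x"] continuous_map_add tendsto_add)
qed

lemma ring_baire_one_ring: "ring (baire_one_ring X)"
  unfolding baire_one_ring_def
  by (rule ring.subring_is_ring[OF ring_function_ring subring_baire_one])

lemma subring_T_prime_baire_one_iff:
  "subring (T_prime X) (baire_one_ring X) \<longleftrightarrow> T_prime X \<subseteq> baire_one X"
proof
  assume "subring (T_prime X) (baire_one_ring X)"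
  then show "T_prime X \<subseteq> baire_one X"
    using subringE(1) by (fastforce simp: baire_one_ring_def)
next
  assume "T_prime X \<subseteq> baire_one X"
  moreover have "ring ((function_ring X)\<lparr>carrier := T_prime X\<rparr>)"
    by (rule ring.subring_is_ring[OF ring_function_ring subring_T_prime])
  ultimately show "subring (T_prime X) (baire_one_ring X)"
    by (intro ring.ring_incl_imp_subring[OF ring_baire_one_ring]) (auto simp: baire_one_ring_def)
qed

end

theory Submission
  imports Defs
begin

text \<open>
  Every function that vanishes off \<open>A\<close> belongs to \<open>T'(X)\<close>, so it suffices to find a function on
  \<open>A\<close> that is not a pointwise limit of continuous functions on \<open>X\<close>. Suppose there is none.
  Approximating indicators of points shows that \<open>A\<close> is Hausdorff, so \<open>A\<close> contains a compact set
  \<open>K\<close> with at least continuum many points. Choose \<open>h\<close> mapping \<open>K\<close> onto the reals, with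
  \<open>h = lim s\<^sub>n\<close>, and put \<open>F = (s\<^sub>n)\<^sub>n\<close>, a continuous map into the space of real sequences
  through which \<open>h\<close> factors. The \<open>F\<^sub>\<sigma>\<close> sets of sequences can be listed as \<open>T r\<close> with \<open>r\<close> real.
  Let \<open>B\<close> consist of those \<open>y \<in> F(K)\<close> for which \<open>y \<notin> T (lim y)\<close>. The indicator of the preimage of
  \<open>B\<close> in \<open>K\<close> is again a limit of continuous functions, so this preimage is \<open>F\<^sub>\<sigma>\<close> and, by compactness,
  so is \<open>B\<close>. But if \<open>B = T (h x)\<close>, then \<open>F x \<in> B\<close> iff \<open>F x \<notin> B\<close>.
\<close>

text \<open>By second countability a sequence of closed sets is coded by a set of pairs of naturals,
  and there are only continuum many such sets.\<close>

lemma countable_closed_unions_indexed_by_reals: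
  obtains T :: "real \<Rightarrow> 'b::second_countable_topology set"
  where "\<And>C :: nat \<Rightarrow> 'b set. (\<And>n. closed (C n)) \<Longrightarrow> (\<Union>n. C n) \<in> range T"
proof -
  obtain \<B> :: "'b set set" where "countable \<B>" and basis: "topological_basis \<B>"
    using ex_countable_basis by blast
  have "\<B> \<noteq> {}"
    using topological_basisE[OF basis open_UNIV UNIV_I] by blast
  then obtain U :: "nat \<Rightarrow> 'b set" where U: "range U = \<B>"
    using \<open>countable \<B>\<close> by (metis range_from_nat_into)
  obtain e :: "real \<Rightarrow> nat set" where e: "bij e"
    using eqpoll_sym[OF nat_sets_eqpoll_reals] unfolding eqpoll_def by blast
  \<comment> \<open>\<open>e r\<close> is read as a set of pairs \<open>(m, k)\<close>: the
    \<open>m\<close>-th closed set omits exactly the basic open sets \<open>U k\<close> paired with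
    \<open>m\<close>.\<close>
  define T where "T r = (\<Union>m. - \<Union>{U k |k. prod_encode (m, k) \<in> e r})" for r
  have "(\<Union>n. C n) \<in> range T" if C: "\<And>n. closed (C n)" for C :: "nat \<Rightarrow> 'b set"
  proof -
    define I where "I = {prod_encode (m, k) |m k. U k \<subseteq> - C m}"
    obtain r where r: "e r = I"
      using e by (metis bij_pointE)
    have "\<Union>{U k |k. prod_encode (m, k) \<in> e r} = - C m" for m
    proof (intro equalityI subsetI)
      fix x assume "x \<in> - C m"
      moreover have "open (- C m)"
        using C by (simp add: open_Compl)
      ultimately obtain V where "V \<in> \<B>" "x \<in> V" "V \<subseteq> - C m"
        using topological_basisE[OF basis] by metis
      then show "x \<in> \<Union>{U k |k. prod_encode (m, k) \<in> e r}"
        using U by (auto simp: r I_def)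
    qed (auto simp: r I_def)
    then have "T r = (\<Union>n. C n)"
      by (simp add: T_def)
    then show ?thesis
      by (metis rangeI)
  qed
  then show thesis
    by (rule that)
qed

lemma exists_non_limit_of_continuous:
  assumes "compactin X K" and card: "(UNIV :: real set) \<lesssim> K"
  obtains f :: "'a \<Rightarrow> real"
  where "\<nexists>s. (\<forall>n::nat. continuous_map X euclideanreal (s n)) \<and> (\<forall>x\<in>K. (\<lambda>n. s n x) \<longlonglongrightarrow> f x)"
proof -
  have False
    if lims: "\<And>f :: 'a \<Rightarrow> real. \<exists>s. (\<forall>n::nat. continuous_map X euclideanreal (s n)) \<and>
                (\<forall>x\<in>K. (\<lambda>n. s n x) \<longlonglongrightarrow> f x)"
  proof -
    obtain j :: "real \<Rightarrow> 'a" where j: "inj j" "range j \<subseteq> K"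
      using card unfolding lepoll_def by blast
    \<comment> \<open>\<open>the_inv j\<close> is a map of \<open>K\<close> onto the reals; its
      values off \<open>range j\<close> do not matter.\<close>
    obtain s :: "nat \<Rightarrow> 'a \<Rightarrow> real" where s: "\<And>n. continuous_map X euclideanreal (s n)"
        "\<And>x. x \<in> K \<Longrightarrow> (\<lambda>n. s n x) \<longlonglongrightarrow> the_inv j x"
      using lims[of "the_inv j"] by blast
    define F where "F x = (\<lambda>n. s n x)" for x
    have limF: "lim (F x) = the_inv j x" if "x \<in> K" for x
      using s(2)[OF that] by (simp add: F_def limI)
    have contF: "continuous_map X euclidean F"
      unfolding F_def euclidean_product_topology[symmetric]
      using s(1) by (simp add: continuous_map_componentwise_UNIV)
    obtain T :: "real \<Rightarrow> (nat \<Rightarrow> real) set"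
      where T: "\<And>C :: nat \<Rightarrow> _. (\<And>n. closed (C n)) \<Longrightarrow> (\<Union>n. C n) \<in> range T"
      by (fact countable_closed_unions_indexed_by_reals)
    define B where "B = {y \<in> F ` K. y \<notin> T (lim y)}"
    obtain t :: "nat \<Rightarrow> 'a \<Rightarrow> real" where t: "\<And>n. continuous_map X euclideanreal (t n)"
        "\<And>x. x \<in> K \<Longrightarrow> (\<lambda>n. t n x) \<longlonglongrightarrow> of_bool (F x \<in> B)"
      using lims[of "\<lambda>x. of_bool (F x \<in> B)"] by blast
    \<comment> \<open>The threshold 1/2 separates the two values of the indicator, and the
      non-strict inequality makes each condition closed.\<close>
    define P where "P m = K \<inter> (\<Inter>n\<in>{m..}. {x \<in> topspace X. t n x \<in> {1/2..}})" for m
    have P_iff: "(\<exists>m. x \<in> P m) \<longleftrightarrow> F x \<in> B" if x: "x \<in> K" for x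
    proof
      assume "\<exists>m. x \<in> P m"
      then obtain m where "\<forall>n\<ge>m. 1/2 \<le> t n x"
        by (auto simp: P_def)
      then have "1/2 \<le> (of_bool (F x \<in> B) :: real)"
        using LIMSEQ_le_const[OF t(2)[OF x]] by blast
      then show "F x \<in> B"
        by (simp split: if_splits add: of_bool_def)
    next
      assume "F x \<in> B"
      then have "eventually (\<lambda>n. 1/2 < t n x) sequentially"
        using order_tendstoD(1)[OF t(2)[OF x], of "1/2"] by simp
      moreover have "x \<in> topspace X"
        using x \<open>compactin X K\<close> compactin_subset_topspace by blast
      ultimately show "\<exists>m. x \<in> P m"
        using x by (fastforce simp: P_def eventually_sequentially intro: less_imp_le)
    qed
    have "closed (F ` P m)" for m
    proof -
      have "closedin X {x \<in> topspace X. t n x \<in> {1/2..}}" for n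
        by (rule closedin_continuous_map_preimage[OF t(1)]) simp
      then have "closedin X (\<Inter>n\<in>{m..}. {x \<in> topspace X. t n x \<in> {1/2..}})"
        by (intro closedin_Inter) auto
      then have "compactin X (P m)"
        unfolding P_def using \<open>compactin X K\<close> by (intro compact_Int_closedin)
      then show ?thesis
        \<comment> \<open>Compact sets of real sequences are closed because the sequence space is
          Hausdorff.\<close>
        using image_compactin[OF _ contF] compact_imp_closed by auto
    qed
    moreover have "(\<Union>m. F ` P m) = B"
    proof -
      have "P m \<subseteq> K" for m
        by (auto simp: P_def)
      then show ?thesis
        using P_iff by (fastforce simp: B_def)
    qed
    ultimately obtain r where r: "B = T r"
      using T[of "\<lambda>m. F ` P m"] by auto
    \<comment> \<open>Diagonal point: \<open>F (j r)\<close> has limit \<open>r\<close>, the very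
      index of \<open>B\<close>.\<close>
    have "j r \<in> K" and "the_inv j (j r) = r"
      using j by (auto intro: the_inv_f_f)
    then have "F (j r) \<in> B \<longleftrightarrow> F (j r) \<notin> T r"
      using limF[of "j r"] by (simp add: B_def)
    then show False
      using r by blast
  qed
  then show thesis
    using that by blast
qed

text \<open>If a neighbourhood of a point of \<open>U\<close> met \<open>U\<close> in that point
  only, the intersection would be an open singleton. So \<open>U\<close> accumulates at each of its
  points, and the closure inherits this.\<close>

lemma crowded_derived_set_of_closure_of_open:
  assumes crowded: "\<And>x. \<not> openin X {x}" and U: "openin X U"
  shows "X derived_set_of (X closure_of U) = X closure_of U"
proof -
  have "U \<subseteq> X derived_set_of U"
  proof
    fix x assume x: "x \<in> U"
    have "\<exists>y\<noteq>x. y \<in> U \<and> y \<in> V" if V: "x \<in> V" "openin X V" for V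
    proof (rule ccontr)
      assume "\<not> ?thesis"
      then have "V \<inter> U = {x}"
        using x V by blast
      then show False
        using crowded[of x] V U by (metis openin_Int)
    qed
    then show "x \<in> X derived_set_of U"
      using x U openin_subset by (fastforce simp: in_derived_set_of)
  qed
  then have "X closure_of U \<subseteq> X derived_set_of U"
    by (auto simp: closure_of)
  also have "\<dots> \<subseteq> X derived_set_of (X closure_of U)"
    using U by (intro derived_set_of_mono closure_of_subset openin_subset)
  finally show ?thesis
    using closedin_closure_of[of X U] by (simp add: closedin_contains_derived_set subset_antisym)
qed

text \<open>An open set inside a compact set has compact closure. This closure is perfect, hence has
  at least continuum many points.\<close>

lemma crowded_locally_compact_exists_large_compact:
  assumes "locally_compact_space X" "Hausdorff_space X" "topspace X \<noteq> {}"
    and crowded: "\<And>x. \<not> openin X {x}"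
  obtains K where "compactin X K" "(UNIV :: real set) \<lesssim> K"
proof -
  obtain x where "x \<in> topspace X"
    using \<open>topspace X \<noteq> {}\<close> by blast
  then obtain U C where UC: "openin X U" "compactin X C" "x \<in> U" "U \<subseteq> C"
    using \<open>locally_compact_space X\<close> unfolding locally_compact_space_def by blast
  have "X closure_of U \<subseteq> C"
    using UC \<open>Hausdorff_space X\<close> by (simp add: closure_of_minimal compactin_imp_closedin)
  then have "compactin X (X closure_of U)"
    using UC closed_compactin closedin_closure_of by blast
  moreover have "X closure_of U \<noteq> {}"
    using UC(1,3) closure_of_subset[OF openin_subset[OF UC(1)]] by blast
  then have "(UNIV :: real set) \<lesssim> X closure_of U"
    using assms crowded_derived_set_of_closure_of_open[OF crowded \<open>openin X U\<close>]
    by (intro lepoll_perfect_set) auto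
  ultimately show thesis
    by (rule that)
qed

text \<open>The complement of \<open>A\<close> is open and dense, and the function is constant
  there.\<close>

lemma extension_by_zero_in_T_prime:
  assumes "closedin X A" "nowhere_dense_in X A"
  shows "(\<lambda>x\<in>topspace X. if x \<in> A then f x else 0) \<in> T_prime X"
proof -
  have "X interior_of A = {}"
    using assms by (simp add: nowhere_dense_in_def closure_of_closedin)
  then have "X closure_of (topspace X - A) = topspace X"
    by (simp add: closure_of_complement)
  moreover have "continuous_map (subtopology X (topspace X - A)) euclideanreal
      (\<lambda>x\<in>topspace X. if x \<in> A then f x else 0)"
    by (rule continuous_map_eq[of _ _ "\<lambda>_. 0"]) auto
  ultimately show ?thesis
    using \<open>closedin X A\<close> by (auto simp: T_prime_def function_ring_def intro!: exI[of _ "topspace X - A"])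
qed

lemma Hausdorff_space_if_all_limits_of_continuous:
  assumes lims: "\<And>f :: 'a \<Rightarrow> real. \<exists>s. (\<forall>n::nat. continuous_map X euclideanreal (s n)) \<and>
                   (\<forall>x\<in>topspace X. (\<lambda>n. s n x) \<longlonglongrightarrow> f x)"
  shows "Hausdorff_space X"
  unfolding Hausdorff_space_def
proof (intro allI impI)
  fix x y assume xy: "x \<in> topspace X \<and> y \<in> topspace X \<and> x \<noteq> y"
  obtain s :: "nat \<Rightarrow> 'a \<Rightarrow> real" where s: "\<And>n. continuous_map X euclideanreal (s n)"
      "\<And>z. z \<in> topspace X \<Longrightarrow> (\<lambda>n. s n z) \<longlonglongrightarrow> of_bool (z = x)"
    using lims[of "\<lambda>z. of_bool (z = x)"] by blast
  \<comment> \<open>Otherwise the limits 1 at \<open>x\<close> and 0 at \<open>y\<close> would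
    coincide.\<close>
  have "\<exists>n. s n x \<noteq> s n y"
  proof (rule ccontr)
    assume "\<not> ?thesis"
    then have "(\<lambda>n. s n x) = (\<lambda>n. s n y)"
      by simp
    then show False
      using s(2)[of x] s(2)[of y] xy LIMSEQ_unique by fastforce
  qed
  then obtain n V W where VW: "open V" "open W" "s n x \<in> V" "s n y \<in> W" "V \<inter> W = {}"
    using hausdorff by metis
  show "\<exists>V W. openin X V \<and> openin X W \<and> x \<in> V \<and> y \<in> W \<and> disjnt V W"
  proof (intro exI conjI)
    show "openin X {z \<in> topspace X. s n z \<in> V}" "openin X {z \<in> topspace X. s n z \<in> W}"
      using VW by (auto intro: openin_continuous_map_preimage[OF s(1)])
  qed (use VW xy in \<open>auto simp: disjnt_iff\<close>)
qed

theorem proposition3p9: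
  fixes X :: "'a topology" and A :: "'a set"
  assumes "topspace X \<noteq> {}" and "t1_space X"
    and "A \<noteq> {}"
    and "nowhere_dense_in X A"
    and "perfect_in X A"
    and "locally_compact_space (subtopology X A)"
  shows "\<not> subring (T_prime X) (baire_one_ring X)"
proof
  assume "subring (T_prime X) (baire_one_ring X)"
  then have sub: "T_prime X \<subseteq> baire_one X"
    by (simp add: subring_T_prime_baire_one_iff)
  let ?Y = "subtopology X A"
  have "closedin X A" and crowded: "\<And>x. x \<in> A \<Longrightarrow> \<not> openin ?Y {x}"
    using assms by (auto simp: perfect_in_def)
  have A: "topspace ?Y = A" "A \<subseteq> topspace X"
    using \<open>closedin X A\<close> closedin_subset by fastforce+
  have lims: "\<exists>s. (\<forall>n::nat. continuous_map ?Y euclideanreal (s n)) \<and>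
      (\<forall>x\<in>topspace ?Y. (\<lambda>n. s n x) \<longlonglongrightarrow> f x)" for f :: "'a \<Rightarrow> real"
  proof -
    have "(\<lambda>x\<in>topspace X. if x \<in> A then f x else 0) \<in> baire_one X"
      using sub extension_by_zero_in_T_prime[OF \<open>closedin X A\<close> \<open>nowhere_dense_in X A\<close>] by blast
    then obtain s :: "nat \<Rightarrow> 'a \<Rightarrow> real" where s: "\<And>n. continuous_map X euclideanreal (s n)"
        "\<And>x. x \<in> topspace X \<Longrightarrow>
          (\<lambda>n. s n x) \<longlonglongrightarrow> (\<lambda>x\<in>topspace X. if x \<in> A then f x else 0) x"
      unfolding baire_one_def by blast
    \<comment> \<open>The approximants on \<open>X\<close> of the extension by zero restrict to
      approximants of \<open>f\<close> on \<open>A\<close>.\<close>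
    have "(\<lambda>n. s n x) \<longlonglongrightarrow> f x" if "x \<in> A" for x
      using s(2)[of x] that A by auto
    then show ?thesis
      using s(1) A by (intro exI[of _ s]) (auto intro: continuous_map_from_subtopology)
  qed
  then have "Hausdorff_space ?Y"
    by (rule Hausdorff_space_if_all_limits_of_continuous)
  moreover have "\<not> openin ?Y {x}" for x
    using crowded A openin_subset by fastforce
  ultimately obtain K where K: "compactin ?Y K" "(UNIV :: real set) \<lesssim> K"
    using crowded_locally_compact_exists_large_compact assms A by metis
  obtain f :: "'a \<Rightarrow> real" where "\<nexists>s. (\<forall>n::nat. continuous_map ?Y euclideanreal (s n)) \<and>
      (\<forall>x\<in>K. (\<lambda>n. s n x) \<longlonglongrightarrow> f x)"
    using exists_non_limit_of_continuous[OF K] by blast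
  then show False
    using lims[of f] compactin_subset_topspace[OF K(1)] by blast
qed

end
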